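(* For every real number $R \geq 1$ there exists a finite metric space $X$ such that $\lim_{t \to 0}|tX| = R$.
   Context: For a finite metric space $(X,d)$ let $Z_X$ be the $X \times X$ real matrix with entries $Z_X(x,y) = e^{-d(x,y)}$. If $Z_X$ is invertible, the magnitude $|X|$ is the sum of all entries of $Z_X^{-1}$. For $t \in (0,\infty)$, $tX$ denotes the metric space with the same underlying set as $X$ and metric $t\cdot d$. The magnitude function $t \mapsto |tX|$ is defined whenever $Z_{tX}$ is invertible; this is the case for all but finitely many $t>0$, in particular for all sufficiently small $t>0$. The limit $\lim_{t\to 0}|tX|$ means the limit as $t \to 0$ through positive values for which $|tX|$ is defined. *)

theory Defs
  imports "HOL-Analysis.Analysis"
begin

text \<open>
  A finite metric space is a finite carrier set \<open>X\<close> with \<open>Metric_space X d\<close>.  An \<open>X \<times> X\<close> real matrix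
  is a function \<open>'a \<Rightarrow> 'a \<Rightarrow> real\<close> of which only the entries with both indices in \<open>X\<close> matter;
  no order on \<open>X\<close> and no ambient finite type is needed, so the space may be chosen inside a statement.
\<close>

definition similarity_matrix :: "('a \<Rightarrow> 'a \<Rightarrow> real) \<Rightarrow> 'a \<Rightarrow> 'a \<Rightarrow> real" where
  "similarity_matrix d x y = exp (- d x y)"

definition matrix_mult_on :: "'a set \<Rightarrow> ('a \<Rightarrow> 'a \<Rightarrow> real) \<Rightarrow> ('a \<Rightarrow> 'a \<Rightarrow> real) \<Rightarrow> 'a \<Rightarrow> 'a \<Rightarrow> real" where
  "matrix_mult_on X A B x y = (\<Sum>z\<in>X. A x z * B z y)"

definition inverse_matrices_on :: "'a set \<Rightarrow> ('a \<Rightarrow> 'a \<Rightarrow> real) \<Rightarrow> ('a \<Rightarrow> 'a \<Rightarrow> real) \<Rightarrow> bool" where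
  "inverse_matrices_on X A B \<longleftrightarrow>
     (\<forall>x\<in>X. \<forall>y\<in>X. matrix_mult_on X A B x y = of_bool (x = y)
                  \<and> matrix_mult_on X B A x y = of_bool (x = y))"

definition invertible_matrix_on :: "'a set \<Rightarrow> ('a \<Rightarrow> 'a \<Rightarrow> real) \<Rightarrow> bool" where
  "invertible_matrix_on X A \<longleftrightarrow> (\<exists>B. inverse_matrices_on X A B)"

definition inverse_matrix_on :: "'a set \<Rightarrow> ('a \<Rightarrow> 'a \<Rightarrow> real) \<Rightarrow> 'a \<Rightarrow> 'a \<Rightarrow> real" where
  "inverse_matrix_on X A = (SOME B. inverse_matrices_on X A B)"

text \<open>The entries of \<open>inverse_matrix_on\<close> with indices in \<open>X\<close> do not depend on the choice made by \<open>SOME\<close>:\<close>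

lemma inverse_matrices_on_unique:
  assumes "finite X" "inverse_matrices_on X A B" "inverse_matrices_on X A C" "x \<in> X" "y \<in> X"
  shows "B x y = C x y"
proof -
  have "B x y = (\<Sum>z\<in>X. B x z * of_bool (z = y))"
    using assms by (simp add: of_bool_def if_distrib cong: if_cong)
  also have "\<dots> = (\<Sum>z\<in>X. B x z * (\<Sum>w\<in>X. A z w * C w y))"
    using assms by (intro sum.cong) (auto simp: inverse_matrices_on_def matrix_mult_on_def)
  also have "\<dots> = (\<Sum>w\<in>X. (\<Sum>z\<in>X. B x z * A z w) * C w y)"
    by (simp add: sum_distrib_left sum_distrib_right mult.assoc) (rule sum.swap)
  also have "\<dots> = (\<Sum>w\<in>X. of_bool (x = w) * C w y)"
    using assms by (intro sum.cong) (auto simp: inverse_matrices_on_def matrix_mult_on_def)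
  also have "\<dots> = C x y"
    using assms by (simp add: of_bool_def if_distribR sum.delta if_distrib[of "\<lambda>c. c * _"] cong: if_cong)
  finally show ?thesis .
qed

lemma inverse_matrix_on_eq:
  assumes "finite X" "inverse_matrices_on X A B" "x \<in> X" "y \<in> X"
  shows "inverse_matrix_on X A x y = B x y"
  using assms inverse_matrices_on_unique someI[of "inverse_matrices_on X A" B]
  unfolding inverse_matrix_on_def by metis

definition has_magnitude :: "'a set \<Rightarrow> ('a \<Rightarrow> 'a \<Rightarrow> real) \<Rightarrow> bool" where
  "has_magnitude X d \<longleftrightarrow> invertible_matrix_on X (similarity_matrix d)"

text \<open>Only meaningful if \<open>has_magnitude X d\<close>.\<close>

definition magnitude :: "'a set \<Rightarrow> ('a \<Rightarrow> 'a \<Rightarrow> real) \<Rightarrow> real" where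
  "magnitude X d = (\<Sum>x\<in>X. \<Sum>y\<in>X. inverse_matrix_on X (similarity_matrix d) x y)"

definition scaled_dist :: "real \<Rightarrow> ('a \<Rightarrow> 'a \<Rightarrow> real) \<Rightarrow> 'a \<Rightarrow> 'a \<Rightarrow> real" where
  "scaled_dist t d x y = t * d x y"

text \<open>
  The limit at \<open>0\<close> of the magnitude function is taken along its domain of definition.  The
  limit-point condition keeps it from holding vacuously: if \<open>0\<close> were isolated from the domain, the
  filter \<open>at 0 within \<dots>\<close> would be \<open>bot\<close> and every real number would be a limit.  For a finite metric
  space the condition is always satisfied.
\<close>

definition magnitude_domain :: "'a set \<Rightarrow> ('a \<Rightarrow> 'a \<Rightarrow> real) \<Rightarrow> real set" where
  "magnitude_domain X d = {t. 0 < t \<and> has_magnitude X (scaled_dist t d)}"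

definition has_small_scale_limit :: "'a set \<Rightarrow> ('a \<Rightarrow> 'a \<Rightarrow> real) \<Rightarrow> real \<Rightarrow> bool" where
  "has_small_scale_limit X d L \<longleftrightarrow>
     0 islimpt magnitude_domain X d \<and>
     ((\<lambda>t. magnitude X (scaled_dist t d)) \<longlongrightarrow> L) (at 0 within magnitude_domain X d)"

end

theory Submission
  imports Defs "HOL-Real_Asymp.Real_Asymp"
begin

text \<open>
  The spaces realising all values are unions of two equilateral pieces: \<open>m\<close> points at mutual
  distance \<open>a\<close>, \<open>n\<close> points at mutual distance \<open>b\<close>, and distance \<open>c\<close> between points of different
  pieces.  The similarity matrix is constant up to a diagonal term on each block, so its inverse has
  the same shape (\<open>inverse_matrices_on_block_matrix\<close>), and the magnitude is a quotient of two
  explicit exponential polynomials in \<open>t\<close> (\<open>has_magnitude_two_block\<close>).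

  Both numerator and denominator vanish at \<open>t = 0\<close>, and their derivatives there coincide; this is
  why the limit is usually \<open>1\<close>.  It can differ from \<open>1\<close> only if that common derivative is zero,
  which is one linear equation in \<open>a\<close>, \<open>b\<close>, \<open>c\<close>.  In terms of the mean distances
  \<open>\<alpha> = (m - 1) a / m\<close> and \<open>\<beta> = (n - 1) b / n\<close> inside the two pieces the equation reads
  \<open>c = (\<alpha> + \<beta>) / 2\<close>, and the ratio of the second order terms is
  \<open>1 + (\<alpha> - \<beta>)\<^sup>2 / (2 (\<alpha>\<^sup>2 / (m - 1) + \<beta>\<^sup>2 / (n - 1)))\<close> (\<open>two_block_small_scale_limit\<close>).

  The triangle inequality only demands \<open>a \<le> 2 c\<close> and \<open>b \<le> 2 c\<close>.  With \<open>n = 2\<close> and \<open>\<beta> = 1\<close> it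
  permits every \<open>\<alpha>\<close> from \<open>1\<close> to \<open>m - 1\<close>.  At \<open>\<alpha> = 1\<close> the limit is \<open>1\<close>, at \<open>\<alpha> = m - 1\<close> it grows
  linearly with \<open>m\<close>, and the intermediate value theorem gives everything in between.
\<close>

section \<open>Two-block matrices and their inverses\<close>

definition block_matrix ::
    "'a set \<Rightarrow> real \<Rightarrow> real \<Rightarrow> real \<Rightarrow> real \<Rightarrow> real \<Rightarrow> 'a \<Rightarrow> 'a \<Rightarrow> real" where
  "block_matrix A e u f v w x y =
     (if x \<in> A then (if y \<in> A then e * of_bool (x = y) + u else w)
      else (if y \<in> A then w else f * of_bool (x = y) + v))"

lemma sum_diagonal_plus_constant:
  fixes e g e' g' :: real
  assumes "finite S"
  shows "(\<Sum>z\<in>S. (e * of_bool (x = z) + g) * (e' * of_bool (z = y) + g')) =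
     e * e' * of_bool (x = y \<and> x \<in> S) + e * g' * of_bool (x \<in> S) + e' * g * of_bool (y \<in> S)
     + real (card S) * g * g'"
proof -
  have "(\<Sum>z\<in>S. (e * of_bool (x = z) + g) * (e' * of_bool (z = y) + g')) =
     (\<Sum>z\<in>S. (if z = x then e * e' * of_bool (x = y) else 0) + (if z = x then e * g' else 0)
        + (if z = y then e' * g else 0) + g * g')"
    by (intro sum.cong) (auto simp: algebra_simps)
  also have "\<dots> = e * e' * of_bool (x = y \<and> x \<in> S) + e * g' * of_bool (x \<in> S)
     + e' * g * of_bool (y \<in> S) + real (card S) * g * g'"
    using assms by (simp add: sum.distrib)
  finally show ?thesis .
qed

text \<open>
  For \<open>z\<close> in a fixed block both factors are of the form diagonal plus constant, with constants
  depending only on the blocks of \<open>x\<close> and \<open>y\<close>; so each block contributes one instance of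
  \<open>sum_diagonal_plus_constant\<close>.
\<close>

lemma matrix_mult_on_block_matrix:
  assumes fin: "finite X" and A: "A \<subseteq> X" and x: "x \<in> X" and y: "y \<in> X"
  defines "m \<equiv> real (card A)" and "n \<equiv> real (card (X - A))"
  shows "matrix_mult_on X (block_matrix A e u f v w) (block_matrix A e' u' f' v' w') x y =
    (if x \<in> A then
       (if y \<in> A then e * e' * of_bool (x = y) + (e * u' + u * e' + m * u * u' + n * w * w')
        else e * w' + m * u * w' + n * w * v' + w * f')
     else
       (if y \<in> A then f * w' + n * v * w' + m * w * u' + w * e'
        else f * f' * of_bool (x = y) + (f * v' + v * f' + n * v * v' + m * w * w')))"
proof -
  have finA: "finite A" using fin A finite_subset by blast
  define F where
    "F = (\<lambda>z. block_matrix A e u f v w x z * block_matrix A e' u' f' v' w' z y)"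
  have inner: "sum F A = (\<Sum>z\<in>A. (e * of_bool (x = z) + (if x \<in> A then u else w)) *
      (e' * of_bool (z = y) + (if y \<in> A then u' else w')))"
    unfolding F_def block_matrix_def by (intro sum.cong) auto
  have outer: "sum F (X - A) = (\<Sum>z\<in>X - A. (f * of_bool (x = z) + (if x \<in> A then w else v)) *
      (f' * of_bool (z = y) + (if y \<in> A then w' else v')))"
    unfolding F_def block_matrix_def by (intro sum.cong) auto
  have "matrix_mult_on X (block_matrix A e u f v w) (block_matrix A e' u' f' v' w') x y =
      sum F (X - A) + sum F A"
    unfolding matrix_mult_on_def F_def using sum.subset_diff[OF A fin] by blast
  then show ?thesis
    unfolding inner outer sum_diagonal_plus_constant[OF finA]
      sum_diagonal_plus_constant[OF finite_Diff[OF fin, of A]]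
    using x y by (auto simp: m_def n_def algebra_simps)
qed

text \<open>
  On functions constant on both blocks the matrix acts as the \<open>2 \<times> 2\<close> matrix with rows
  \<open>(P, n w)\<close> and \<open>(m w, Q)\<close>, whose determinant is \<open>D\<close>; on functions supported in one block with
  sum zero it acts as the scalar \<open>e\<close> or \<open>f\<close>.  Inverting each part gives the entries below.
\<close>

lemma inverse_matrices_on_block_matrix:
  fixes e u f v w :: real
  assumes fin: "finite X" and A: "A \<subseteq> X"
  defines "m \<equiv> real (card A)" and "n \<equiv> real (card (X - A))"
  defines "P \<equiv> e + m * u" and "Q \<equiv> f + n * v"
  defines "D \<equiv> P * Q - m * n * w\<^sup>2"
  assumes nz: "m \<noteq> 0" "n \<noteq> 0" "e \<noteq> 0" "f \<noteq> 0" "D \<noteq> 0"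
  shows "inverse_matrices_on X (block_matrix A e u f v w)
    (block_matrix A (1 / e) ((Q / D - 1 / e) / m) (1 / f) ((P / D - 1 / f) / n) (- w / D))"
proof -
  define u' where "u' = (Q / D - 1 / e) / m"
  define v' where "v' = (P / D - 1 / f) / n"
  define w' where "w' = - w / D"
  have mu: "m * u' = Q / D - 1 / e" and nv: "n * v' = P / D - 1 / f"
    using nz by (auto simp: u'_def v'_def)
  have Dw: "D * w' = - w" using nz by (simp add: w'_def)
  have PQ: "P * Q / D = 1 + m * n * w\<^sup>2 / D"
    using nz by (simp add: D_def field_simps)
  have w_w': "w * w' = - (w\<^sup>2 / D)" by (simp add: w'_def power2_eq_square)
  have "m * (e * u' + u / e + m * u * u' + n * w * w') = P * (m * u') + m * u / e + m * n * (w * w')"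
    by (simp add: P_def algebra_simps)
  also have "\<dots> = P * Q / D - P / e + m * u / e - m * n * w\<^sup>2 / D"
    unfolding mu w_w' by (simp add: algebra_simps)
  also have "\<dots> = 0"
    unfolding PQ using nz by (simp add: P_def add_divide_distrib)
  finally have AA: "e * u' + u / e + m * u * u' + n * w * w' = 0" using nz by simp
  have "n * (f * v' + v / f + n * v * v' + m * w * w') = Q * (n * v') + n * v / f + m * n * (w * w')"
    by (simp add: Q_def algebra_simps)
  also have "\<dots> = P * Q / D - Q / f + n * v / f - m * n * w\<^sup>2 / D"
    unfolding nv w_w' by (simp add: algebra_simps)
  also have "\<dots> = 0"
    unfolding PQ using nz by (simp add: Q_def add_divide_distrib)
  finally have BB: "f * v' + v / f + n * v * v' + m * w * w' = 0" using nz by simp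
  have "e * w' + m * u * w' + n * w * v' + w / f = P * w' + w * (n * v') + w / f"
    by (simp add: P_def algebra_simps)
  also have "\<dots> = 0" unfolding nv by (simp add: w'_def algebra_simps)
  finally have AB: "e * w' + m * u * w' + n * w * v' + w / f = 0" .
  have "f * w' + n * v * w' + m * w * u' + w / e = Q * w' + w * (m * u') + w / e"
    by (simp add: Q_def algebra_simps)
  also have "\<dots> = 0" unfolding mu by (simp add: w'_def algebra_simps)
  finally have BA: "f * w' + n * v * w' + m * w * u' + w / e = 0" .
  show ?thesis
    unfolding inverse_matrices_on_def u'_def[symmetric] v'_def[symmetric] w'_def[symmetric]
  proof (intro ballI conjI)
    fix x y assume xy: "x \<in> X" "y \<in> X"
    show "matrix_mult_on X (block_matrix A e u f v w) (block_matrix A (1/e) u' (1/f) v' w') x y =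
        of_bool (x = y)"
      unfolding matrix_mult_on_block_matrix[OF fin A xy] m_def[symmetric] n_def[symmetric]
      using AA AB BA BB nz by (auto simp: algebra_simps)
    show "matrix_mult_on X (block_matrix A (1/e) u' (1/f) v' w') (block_matrix A e u f v w) x y =
        of_bool (x = y)"
      unfolding matrix_mult_on_block_matrix[OF fin A xy] m_def[symmetric] n_def[symmetric]
      using AA AB BA BB nz by (auto simp: algebra_simps)
  qed
qed

lemma sum_block_matrix:
  assumes fin: "finite X" and A: "A \<subseteq> X"
  defines "m \<equiv> real (card A)" and "n \<equiv> real (card (X - A))"
  shows "(\<Sum>x\<in>X. \<Sum>y\<in>X. block_matrix A e u f v w x y) =
    m * (e + m * u) + n * (f + n * v) + 2 * m * n * w"
proof -
  have finA: "finite A" using fin A finite_subset by blast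
  have row: "(\<Sum>y\<in>X. block_matrix A e u f v w x y) =
      (if x \<in> A then e + m * u + n * w else f + n * v + m * w)" if x: "x \<in> X" for x
  proof -
    have "(\<Sum>y\<in>X. block_matrix A e u f v w x y) =
        (\<Sum>y\<in>X - A. block_matrix A e u f v w x y) + (\<Sum>y\<in>A. block_matrix A e u f v w x y)"
      by (rule sum.subset_diff[OF A fin])
    also have "(\<Sum>y\<in>X - A. block_matrix A e u f v w x y) =
        (\<Sum>y\<in>X - A. (if y = x then f else 0) + (if x \<in> A then w else v))"
      unfolding block_matrix_def by (intro sum.cong) auto
    also have "(\<Sum>y\<in>A. block_matrix A e u f v w x y) =
        (\<Sum>y\<in>A. (if y = x then e else 0) + (if x \<in> A then u else w))"
      unfolding block_matrix_def by (intro sum.cong) auto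
    finally show ?thesis
      using x finA fin by (auto simp: sum.distrib m_def n_def)
  qed
  have "(\<Sum>x\<in>X. \<Sum>y\<in>X. block_matrix A e u f v w x y) =
      (\<Sum>x\<in>X. if x \<in> A then e + m * u + n * w else f + n * v + m * w)"
    by (intro sum.cong refl row)
  also have "\<dots> = (\<Sum>x\<in>X - A. f + n * v + m * w) + (\<Sum>x\<in>A. e + m * u + n * w)"
    unfolding sum.subset_diff[OF A fin] by simp
  also have "\<dots> = m * (e + m * u) + n * (f + n * v) + 2 * m * n * w"
    by (simp add: m_def n_def algebra_simps)
  finally show ?thesis .
qed

section \<open>Spaces made of two equilateral pieces\<close>

definition two_block_dist :: "'a set \<Rightarrow> real \<Rightarrow> real \<Rightarrow> real \<Rightarrow> 'a \<Rightarrow> 'a \<Rightarrow> real" where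
  "two_block_dist A a b c x y =
     (if x = y then 0 else if x \<in> A \<and> y \<in> A then a else if x \<notin> A \<and> y \<notin> A then b else c)"

lemma Metric_space_two_block_dist:
  assumes "0 < a" "0 < b" "0 < c" "a \<le> 2 * c" "b \<le> 2 * c"
  shows "Metric_space X (two_block_dist A a b c)"
proof
  show "0 \<le> two_block_dist A a b c x y" for x y
    using assms by (simp add: two_block_dist_def)
  show "two_block_dist A a b c x y = two_block_dist A a b c y x" for x y
    by (auto simp: two_block_dist_def)
  show "(two_block_dist A a b c x y = 0) = (x = y)" for x y
    using assms by (auto simp: two_block_dist_def)
  show "two_block_dist A a b c x z \<le> two_block_dist A a b c x y + two_block_dist A a b c y z"
    for x y z
    using assms by (simp add: two_block_dist_def)
qed

lemma similarity_matrix_two_block: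
  "similarity_matrix (scaled_dist t (two_block_dist A a b c)) =
    block_matrix A (1 - exp (- a * t)) (exp (- a * t)) (1 - exp (- b * t)) (exp (- b * t))
      (exp (- c * t))"
  by (intro ext)
    (auto simp: similarity_matrix_def scaled_dist_def two_block_dist_def block_matrix_def mult.commute)

text \<open>
  A weighting that is constant on both blocks solves a \<open>2 \<times> 2\<close> linear system; the denominator is
  its determinant, and Cramer's rule gives the numerator for the total weight.
\<close>

definition two_block_numerator :: "real \<Rightarrow> real \<Rightarrow> real \<Rightarrow> real \<Rightarrow> real \<Rightarrow> real \<Rightarrow> real" where
  "two_block_numerator m n a b c t =
     m * (1 + (n - 1) * exp (- b * t)) + n * (1 + (m - 1) * exp (- a * t))
     - 2 * m * n * exp (- c * t)"

definition two_block_denominator :: "real \<Rightarrow> real \<Rightarrow> real \<Rightarrow> real \<Rightarrow> real \<Rightarrow> real \<Rightarrow> real" where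
  "two_block_denominator m n a b c t =
     (1 + (m - 1) * exp (- a * t)) * (1 + (n - 1) * exp (- b * t))
     - m * n * (exp (- c * t))\<^sup>2"

lemma has_magnitude_two_block:
  fixes a b c t :: real
  assumes fin: "finite X" and A: "A \<subseteq> X"
  defines "m \<equiv> real (card A)" and "n \<equiv> real (card (X - A))"
  assumes nz: "m \<noteq> 0" "n \<noteq> 0" "0 < a" "0 < b" "0 < t"
    and D: "two_block_denominator m n a b c t \<noteq> 0"
  shows "has_magnitude X (scaled_dist t (two_block_dist A a b c))"
    and "magnitude X (scaled_dist t (two_block_dist A a b c)) =
      two_block_numerator m n a b c t / two_block_denominator m n a b c t"
proof -
  define p q r where "p = exp (- a * t)" and "q = exp (- b * t)" and "r = exp (- c * t)"
  define P Q where "P = (1 - p) + m * p" and "Q = (1 - q) + n * q"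
  define E where "E = two_block_denominator m n a b c t"
  have E: "E = P * Q - m * n * r\<^sup>2"
    unfolding E_def two_block_denominator_def P_def Q_def p_def q_def r_def
    by (simp add: algebra_simps)
  have N: "two_block_numerator m n a b c t = m * Q + n * P - 2 * m * n * r"
    unfolding two_block_numerator_def P_def Q_def p_def q_def r_def
    by (simp add: algebra_simps)
  have E0: "E \<noteq> 0" using D by (simp add: E_def)
  have pq: "1 - p \<noteq> 0" "1 - q \<noteq> 0" using nz by (auto simp: p_def q_def)
  define B where "B = block_matrix A (1 / (1 - p)) ((Q / E - 1 / (1 - p)) / m)
     (1 / (1 - q)) ((P / E - 1 / (1 - q)) / n) (- r / E)"
  have inv: "inverse_matrices_on X (similarity_matrix (scaled_dist t (two_block_dist A a b c))) B"
    unfolding similarity_matrix_two_block B_def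
    using inverse_matrices_on_block_matrix[OF fin A, of "1 - p" "1 - q" p q r] nz pq E0
    unfolding m_def[symmetric] n_def[symmetric] P_def[symmetric] Q_def[symmetric] E[symmetric]
    unfolding p_def q_def r_def by blast
  then show "has_magnitude X (scaled_dist t (two_block_dist A a b c))"
    unfolding has_magnitude_def invertible_matrix_on_def by blast
  have "magnitude X (scaled_dist t (two_block_dist A a b c)) = (\<Sum>x\<in>X. \<Sum>y\<in>X. B x y)"
    unfolding magnitude_def by (intro sum.cong refl inverse_matrix_on_eq[OF fin inv])
  also have "\<dots> = m * (Q / E) + n * (P / E) + 2 * m * n * (- r / E)"
    unfolding B_def sum_block_matrix[OF fin A] m_def[symmetric] n_def[symmetric]
    using nz by simp
  also have "\<dots> = (m * Q + n * P - 2 * m * n * r) / E"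
    by (simp add: add_divide_distrib diff_divide_distrib)
  finally show "magnitude X (scaled_dist t (two_block_dist A a b c)) =
      two_block_numerator m n a b c t / two_block_denominator m n a b c t"
    unfolding N E_def .
qed

section \<open>The small-scale limit\<close>

definition exp_remainder :: "real \<Rightarrow> real \<Rightarrow> real" where
  "exp_remainder x t = (exp (- x * t) - 1 + x * t) / t\<^sup>2"

text \<open>
  Expanding every exponential with an exact remainder turns the second order expansions below into
  polynomial identities in \<open>t\<close> and the remainders.
\<close>

lemma exp_eq_remainder:
  "t \<noteq> 0 \<Longrightarrow> exp (- x * t) = 1 - x * t + t\<^sup>2 * exp_remainder x t"
  by (simp add: exp_remainder_def)

lemma tendsto_exp_remainder: "(exp_remainder x \<longlongrightarrow> x\<^sup>2 / 2) (at_right 0)"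
proof -
  have "((\<lambda>t. (exp (- x * t) - 1 + x * t) / t\<^sup>2) \<longlongrightarrow> x * x / 2) (at_right 0)"
    by real_asymp
  then show ?thesis by (simp add: exp_remainder_def[abs_def] power2_eq_square)
qed

lemma tendsto_one_minus_exp: "((\<lambda>t. (1 - exp (- x * t)) / t) \<longlongrightarrow> x) (at_right (0::real))"
  by real_asymp

text \<open>
  The balance condition says that the first order terms at \<open>t = 0\<close> of numerator and denominator
  vanish, so both are divisible by \<open>t\<^sup>2\<close>.
\<close>

lemma two_block_numerator_second_order:
  assumes "n * (m - 1) * a + m * (n - 1) * b = 2 * m * n * c"
  shows "((\<lambda>t. two_block_numerator m n a b c t / t\<^sup>2) \<longlongrightarrow>
     m * (n - 1) * (b\<^sup>2 / 2) + n * (m - 1) * (a\<^sup>2 / 2) - 2 * m * n * (c\<^sup>2 / 2)) (at_right 0)"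
proof (rule Lim_transform_eventually)
  show "((\<lambda>t. m * (n - 1) * exp_remainder b t + n * (m - 1) * exp_remainder a t
      - 2 * m * n * exp_remainder c t) \<longlongrightarrow>
     m * (n - 1) * (b\<^sup>2 / 2) + n * (m - 1) * (a\<^sup>2 / 2) - 2 * m * n * (c\<^sup>2 / 2)) (at_right 0)"
    by (intro tendsto_intros tendsto_exp_remainder)
  have "m * (n - 1) * exp_remainder b t + n * (m - 1) * exp_remainder a t
      - 2 * m * n * exp_remainder c t = two_block_numerator m n a b c t / t\<^sup>2" if "0 < t" for t
  proof -
    have "two_block_numerator m n a b c t =
        t * (2 * m * n * c - (n * (m - 1) * a + m * (n - 1) * b)) +
        t\<^sup>2 * (m * (n - 1) * exp_remainder b t + n * (m - 1) * exp_remainder a t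
          - 2 * m * n * exp_remainder c t)"
      unfolding two_block_numerator_def exp_eq_remainder[OF less_imp_neq[OF that, symmetric]]
      by (simp add: algebra_simps)
    then show ?thesis using that assms by simp
  qed
  then show "\<forall>\<^sub>F t in at_right 0. m * (n - 1) * exp_remainder b t + n * (m - 1) * exp_remainder a t
      - 2 * m * n * exp_remainder c t = two_block_numerator m n a b c t / t\<^sup>2"
    by (intro eventually_mono[OF eventually_at_right_less])
qed

lemma two_block_denominator_second_order:
  assumes "n * (m - 1) * a + m * (n - 1) * b = 2 * m * n * c"
  shows "((\<lambda>t. two_block_denominator m n a b c t / t\<^sup>2) \<longlongrightarrow>
     m * (n - 1) * (b\<^sup>2 / 2) + n * (m - 1) * (a\<^sup>2 / 2) - m * n * ((2 * c)\<^sup>2 / 2)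
     + (m - 1) * (n - 1) * (a * b)) (at_right 0)"
proof (rule Lim_transform_eventually)
  let ?g = "\<lambda>t. m * (n - 1) * exp_remainder b t + n * (m - 1) * exp_remainder a t
      - m * n * exp_remainder (2 * c) t
      + (m - 1) * (n - 1) * (((1 - exp (- a * t)) / t) * ((1 - exp (- b * t)) / t))"
  show "(?g \<longlongrightarrow> m * (n - 1) * (b\<^sup>2 / 2) + n * (m - 1) * (a\<^sup>2 / 2) - m * n * ((2 * c)\<^sup>2 / 2)
     + (m - 1) * (n - 1) * (a * b)) (at_right 0)"
    by (intro tendsto_intros tendsto_exp_remainder tendsto_one_minus_exp)
  have "?g t = two_block_denominator m n a b c t / t\<^sup>2" if "0 < t" for t
  proof -
    define p q where "p = exp (- a * t)" and "q = exp (- b * t)"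
    have sq: "(exp (- c * t))\<^sup>2 = exp (- (2 * c) * t)"
      by (simp add: power2_eq_square flip: exp_add)
    have p: "p = 1 - a * t + t\<^sup>2 * exp_remainder a t"
      and q: "q = 1 - b * t + t\<^sup>2 * exp_remainder b t"
      using that exp_eq_remainder[of t a] exp_eq_remainder[of t b] unfolding p_def q_def by auto
    have "two_block_denominator m n a b c t =
        m * n + n * (m - 1) * (p - 1) + m * (n - 1) * (q - 1)
        + (m - 1) * (n - 1) * ((1 - p) * (1 - q)) - m * n * exp (- (2 * c) * t)"
      unfolding two_block_denominator_def sq p_def q_def by (simp add: algebra_simps)
    also have "\<dots> = m * n + n * (m - 1) * (t\<^sup>2 * exp_remainder a t - a * t)
        + m * (n - 1) * (t\<^sup>2 * exp_remainder b t - b * t)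
        + (m - 1) * (n - 1) * ((1 - p) * (1 - q))
        - m * n * (1 - 2 * c * t + t\<^sup>2 * exp_remainder (2 * c) t)"
      using that p q exp_eq_remainder[of t "2 * c"] by simp
    also have "\<dots> = t * (2 * m * n * c - (n * (m - 1) * a + m * (n - 1) * b))
        + t\<^sup>2 * (m * (n - 1) * exp_remainder b t + n * (m - 1) * exp_remainder a t
          - m * n * exp_remainder (2 * c) t) + (m - 1) * (n - 1) * ((1 - p) * (1 - q))"
      by (simp add: algebra_simps)
    also have "\<dots> = t\<^sup>2 * ?g t"
      using that assms unfolding p_def q_def by (simp add: power2_eq_square distrib_left)
    finally show ?thesis using that by simp
  qed
  then show "\<forall>\<^sub>F t in at_right 0. ?g t = two_block_denominator m n a b c t / t\<^sup>2"
    by (intro eventually_mono[OF eventually_at_right_less])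
qed

text \<open>
  With \<open>K = \<alpha>\<^sup>2 / (m - 1) + \<beta>\<^sup>2 / (n - 1)\<close> the second order coefficient of the denominator is
  \<open>m n K / 2\<close>, and that of the numerator exceeds it by \<open>m n (\<alpha> - \<beta>)\<^sup>2 / 4\<close>.  Since \<open>K > 0\<close>, the
  denominator is nonzero for all small \<open>t > 0\<close>, so the magnitude is defined there.
\<close>

theorem two_block_small_scale_limit:
  fixes \<alpha> \<beta> :: real
  assumes fin: "finite X" and A: "A \<subseteq> X"
  defines "m \<equiv> real (card A)" and "n \<equiv> real (card (X - A))"
  assumes mn: "1 < m" "1 < n" and pos: "0 < \<alpha>" "0 < \<beta>"
  shows "has_small_scale_limit X
    (two_block_dist A (\<alpha> * m / (m - 1)) (\<beta> * n / (n - 1)) ((\<alpha> + \<beta>) / 2))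
    (1 + (\<alpha> - \<beta>)\<^sup>2 / (2 * (\<alpha>\<^sup>2 / (m - 1) + \<beta>\<^sup>2 / (n - 1))))"
proof -
  define a b c where "a = \<alpha> * m / (m - 1)" and "b = \<beta> * n / (n - 1)" and "c = (\<alpha> + \<beta>) / 2"
  let ?d = "two_block_dist A a b c"
  define K where "K = \<alpha>\<^sup>2 / (m - 1) + \<beta>\<^sup>2 / (n - 1)"
  have K: "K > 0" unfolding K_def using mn pos by (intro add_pos_pos divide_pos_pos) auto
  have ab: "0 < a" "0 < b" using mn pos by (auto simp: a_def b_def)
  have ma: "(m - 1) * a = \<alpha> * m" and nb: "(n - 1) * b = \<beta> * n"
    using mn by (auto simp: a_def b_def)
  (* Write j for m - 1 or n - 1, so that the only denominator is an atom. *)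
  have square: "j * (\<gamma> * (j + 1) / j)\<^sup>2 = (j + 1) * (\<gamma>\<^sup>2 + \<gamma>\<^sup>2 / j)" if "0 < j" for j \<gamma> :: real
    using that by (simp add: power2_eq_square field_simps)
  have a2: "(m - 1) * a\<^sup>2 = m * (\<alpha>\<^sup>2 + \<alpha>\<^sup>2 / (m - 1))"
    using square[of "m - 1" \<alpha>] mn by (simp add: a_def)
  have b2: "(n - 1) * b\<^sup>2 = n * (\<beta>\<^sup>2 + \<beta>\<^sup>2 / (n - 1))"
    using square[of "n - 1" \<beta>] mn by (simp add: b_def)
  have "n * (m - 1) * a + m * (n - 1) * b = n * ((m - 1) * a) + m * ((n - 1) * b)"
    by (simp add: algebra_simps)
  also have "\<dots> = 2 * m * n * c"
    unfolding ma nb by (simp add: c_def algebra_simps)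
  finally have bal: "n * (m - 1) * a + m * (n - 1) * b = 2 * m * n * c" .

  have "m * (n - 1) * (b\<^sup>2 / 2) + n * (m - 1) * (a\<^sup>2 / 2) - 2 * m * n * (c\<^sup>2 / 2) =
      m * ((n - 1) * b\<^sup>2) / 2 + n * ((m - 1) * a\<^sup>2) / 2 - m * n * c\<^sup>2"
    by simp
  also have "\<dots> = m * n * (K / 2 + (\<alpha> - \<beta>)\<^sup>2 / 4)"
    unfolding a2 b2 by (simp add: c_def K_def power2_eq_square field_simps)
  finally have num_coeff: "m * (n - 1) * (b\<^sup>2 / 2) + n * (m - 1) * (a\<^sup>2 / 2) - 2 * m * n * (c\<^sup>2 / 2) =
      m * n * (K / 2 + (\<alpha> - \<beta>)\<^sup>2 / 4)" .
  have num: "((\<lambda>t. two_block_numerator m n a b c t / t\<^sup>2) \<longlongrightarrow>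
      m * n * (K / 2 + (\<alpha> - \<beta>)\<^sup>2 / 4)) (at_right 0)"
    using two_block_numerator_second_order[OF bal] unfolding num_coeff .

  have "m * (n - 1) * (b\<^sup>2 / 2) + n * (m - 1) * (a\<^sup>2 / 2) - m * n * ((2 * c)\<^sup>2 / 2)
      + (m - 1) * (n - 1) * (a * b) =
      m * ((n - 1) * b\<^sup>2) / 2 + n * ((m - 1) * a\<^sup>2) / 2 - m * n * (2 * c)\<^sup>2 / 2
      + ((m - 1) * a) * ((n - 1) * b)"
    by simp
  also have "\<dots> = m * n * (K / 2)"
    unfolding a2 b2 ma nb by (simp add: c_def K_def power2_eq_square field_simps)
  finally have den_coeff: "m * (n - 1) * (b\<^sup>2 / 2) + n * (m - 1) * (a\<^sup>2 / 2) - m * n * ((2 * c)\<^sup>2 / 2)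
      + (m - 1) * (n - 1) * (a * b) = m * n * (K / 2)" .
  have den: "((\<lambda>t. two_block_denominator m n a b c t / t\<^sup>2) \<longlongrightarrow> m * n * (K / 2)) (at_right 0)"
    using two_block_denominator_second_order[OF bal] unfolding den_coeff .

  have lim_pos: "m * n * (K / 2) > 0" using mn K by simp
  have den0: "\<forall>\<^sub>F t in at_right 0. 0 < t \<and> two_block_denominator m n a b c t \<noteq> 0"
    using order_tendstoD(1)[OF den lim_pos] eventually_at_right_less[of 0]
    by eventually_elim auto
  have dom: "\<forall>\<^sub>F t in at_right 0. t \<in> magnitude_domain X ?d"
    using den0
  proof eventually_elim
    case (elim t)
    then show ?case
      using has_magnitude_two_block(1)[OF fin A, of a b t c] mn ab
      unfolding magnitude_domain_def m_def n_def by auto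
  qed
  have mag: "\<forall>\<^sub>F t in at_right 0. (two_block_numerator m n a b c t / t\<^sup>2) /
      (two_block_denominator m n a b c t / t\<^sup>2) = magnitude X (scaled_dist t ?d)"
    using den0
  proof eventually_elim
    case (elim t)
    then show ?case
      using has_magnitude_two_block(2)[OF fin A, of a b t c] mn ab
      unfolding m_def n_def by auto
  qed
  have "((\<lambda>t. (two_block_numerator m n a b c t / t\<^sup>2) / (two_block_denominator m n a b c t / t\<^sup>2))
      \<longlongrightarrow> (m * n * (K / 2 + (\<alpha> - \<beta>)\<^sup>2 / 4)) / (m * n * (K / 2))) (at_right 0)"
    by (rule tendsto_divide[OF num den less_imp_neq[OF lim_pos, symmetric]])
  then have quotient: "((\<lambda>t. magnitude X (scaled_dist t ?d)) \<longlongrightarrow>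
      (m * n * (K / 2 + (\<alpha> - \<beta>)\<^sup>2 / 4)) / (m * n * (K / 2))) (at_right 0)"
    using mag by (rule Lim_transform_eventually)
  have limit_value: "(m * n * (K / 2 + (\<alpha> - \<beta>)\<^sup>2 / 4)) / (m * n * (K / 2)) = 1 + (\<alpha> - \<beta>)\<^sup>2 / (2 * K)"
    using mn K by (simp add: field_simps)
  have right: "((\<lambda>t. magnitude X (scaled_dist t ?d)) \<longlongrightarrow> 1 + (\<alpha> - \<beta>)\<^sup>2 / (2 * K)) (at_right 0)"
    using quotient unfolding limit_value .
  have "magnitude_domain X ?d \<subseteq> {0<..}" by (auto simp: magnitude_domain_def)
  then have lim: "((\<lambda>t. magnitude X (scaled_dist t ?d)) \<longlongrightarrow> 1 + (\<alpha> - \<beta>)\<^sup>2 / (2 * K))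
      (at 0 within magnitude_domain X ?d)"
    using right by (rule tendsto_within_subset[rotated])
  have "0 islimpt magnitude_domain X ?d"
    unfolding islimpt_approachable
  proof (intro allI impI)
    fix \<epsilon> :: real assume "0 < \<epsilon>"
    then have "\<forall>\<^sub>F t in at_right 0. t \<in> {0<..<\<epsilon>}" by (rule eventually_at_right_real)
    with dom have "\<forall>\<^sub>F t in at_right 0. t \<in> magnitude_domain X ?d \<and> t \<in> {0<..<\<epsilon>}"
      by eventually_elim simp
    then obtain t where "t \<in> magnitude_domain X ?d" "t \<in> {0<..<\<epsilon>}"
      using eventually_happens'[OF trivial_limit_at_right_real] by blast
    then show "\<exists>x'\<in>magnitude_domain X ?d. x' \<noteq> 0 \<and> dist x' 0 < \<epsilon>"
      by (intro bexI[of _ t]) auto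
  qed
  with lim show ?thesis
    unfolding has_small_scale_limit_def a_def b_def c_def K_def by blast
qed

section \<open>Every value from one upwards is attained\<close>

text \<open>
  The parameter \<open>s\<close> is the ratio of the mean distances and \<open>k\<close> is one less than the size of the
  larger piece.  At \<open>s = k\<close> the function equals \<open>1 + (k - 1)\<^sup>2 / (2 (k + 1))\<close>, which is at least
  \<open>(k - 1) / 2\<close>, so any \<open>k \<ge> 2 R + 1\<close> works.
\<close>

lemma two_block_limit_attains:
  fixes R :: real
  assumes "1 \<le> R"
  obtains k :: nat and s :: real
  where "1 \<le> k" "1 \<le> s" "s \<le> k" "1 + (s - 1)\<^sup>2 / (2 * (s\<^sup>2 / k + 1)) = R"
proof -
  obtain k :: nat where k: "2 * R + 1 \<le> k" using real_arch_simple by blast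
  define h where "h = (\<lambda>s::real. 1 + (s - 1)\<^sup>2 / (2 * (s\<^sup>2 / k + 1)))"
  have k1: "1 \<le> real k" using k assms by linarith
  have "h 1 \<le> R" using assms by (simp add: h_def)
  moreover have "R \<le> h k"
  proof -
    have "(R - 1) * (2 * (real k + 1)) = (2 * R - 2) * (real k + 1)" by (simp add: algebra_simps)
    also have "\<dots> \<le> (real k - 3) * (real k + 1)"
      using k by (intro mult_right_mono) auto
    also have "\<dots> \<le> (real k - 1)\<^sup>2" by (simp add: power2_eq_square algebra_simps)
    finally have "R - 1 \<le> (real k - 1)\<^sup>2 / (2 * (real k + 1))"
      using k1 by (simp add: pos_le_divide_eq)
    then show ?thesis using k1 by (simp add: h_def power2_eq_square)
  qed
  moreover have "continuous_on {1..real k} h"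
  proof -
    have nz: "2 * (s\<^sup>2 / k + 1) \<noteq> 0" for s :: real
      by (smt (verit) divide_nonneg_nonneg of_nat_0_le_iff zero_le_power2)
    then show ?thesis unfolding h_def using k1 nz by (intro continuous_intros ballI) simp_all
  qed
  ultimately obtain s where s: "1 \<le> s" "s \<le> real k" "h s = R"
    using IVT'[of h 1 R "real k"] k1 by auto
  show thesis
    using that[of k s] s k1 by (simp add: h_def)
qed

theorem theorem3p8:
  fixes R :: real
  assumes "R \<ge> 1"
  shows "\<exists>(X :: nat set) (d :: nat \<Rightarrow> nat \<Rightarrow> real).
           finite X \<and> Metric_space X d \<and> has_small_scale_limit X d R"
proof -
  obtain k :: nat and s :: real where k: "1 \<le> k" and s: "1 \<le> s" "s \<le> k"
    and R: "1 + (s - 1)\<^sup>2 / (2 * (s\<^sup>2 / k + 1)) = R"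
    using two_block_limit_attains[OF assms] .
  (* Here m = k + 1, n = 2 and the mean distances are \<alpha> = s and \<beta> = 1. *)
  let ?A = "{..<k + 1}"
  let ?X = "{..<k + 3}"
  let ?d = "two_block_dist ?A (s * (real k + 1) / k) 2 ((s + 1) / 2)"
  have diff: "?X - ?A = {k + 1..<k + 3}" by auto
  have "has_small_scale_limit ?X ?d R"
    using two_block_small_scale_limit[of ?X ?A s 1] k s R unfolding diff by (simp add: add.commute)
  moreover have "Metric_space ?X ?d"
  proof (rule Metric_space_two_block_dist)
    have "s / k \<le> 1" using k s by simp
    moreover have "s * (real k + 1) / k = s + s / k" using k by (simp add: field_simps)
    ultimately have "s * (real k + 1) / k \<le> s + 1" by simp
    also have "s + 1 = 2 * ((s + 1) / 2)" by simp
    finally show "s * (real k + 1) / k \<le> 2 * ((s + 1) / 2)" .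
  qed (use k s in auto)
  ultimately show ?thesis by blast
qed

end
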